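(* For every prime power $q$ and every integer $n\geq1$, \[ \frac{1}{q^n}\sum_{f\in\mathcal{M}_n}d_2(f)\,d_2(f+1)=(n+1)^2-\frac{1}{q}(n-1)^2. \]
   Context: $\mathcal{M}_n$ is the set of monic polynomials of degree $n$ in $\mathbb{F}_q[t]$. For a monic polynomial $f$, $d_2(f)$ is the number of ordered pairs $(a_1,a_2)$ of monic polynomials in $\mathbb{F}_q[t]$ with $f=a_1a_2$. *)

theory Defs
  imports Complex_Main "HOL-Library.Cardinality" "HOL-Computational_Algebra.Polynomial"
begin

definition monics :: "nat \<Rightarrow> 'a::comm_semiring_1 poly set" where
  "monics n = {f. lead_coeff f = 1 \<and> degree f = n}"

definition d2 :: "'a::comm_semiring_1 poly \<Rightarrow> nat" where
  "d2 f = card {(a1, a2). lead_coeff a1 = 1 \<and> lead_coeff a2 = 1 \<and> f = a1 * a2}"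

end

theory Submission
  imports Defs
begin

text \<open>
  Every divisor of a monic \<open>f\<close> of degree \<open>n\<close> may be replaced by its cofactor, so the divisors of
  degree \<open>i\<close> can be counted as divisors of degree \<open>min i (n - i)\<close>. Hence \<open>\<Sum>f. d\<^sub>2(f) d\<^sub>2(f+1)\<close>
  only involves pairs \<open>a | f\<close>, \<open>c | f + 1\<close> with \<open>deg a + deg c \<le> n\<close>. Such a pair is comaximal, and
  conversely for a comaximal pair the Chinese remainder theorem gives exactly
  \<open>q^(n - deg a - deg c)\<close> polynomials \<open>f\<close>. Splitting off the monic gcd, all but a proportion \<open>1/q\<close>
  of the pairs of monic polynomials of given positive degrees are comaximal.
\<close>

text \<open>Coprimality in Bezout form; the coefficients \<open>u\<close>, \<open>v\<close> directly
  supply the residue class and the cancellations used later.\<close>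

definition comaximal :: "'a::comm_semiring_1 \<Rightarrow> 'a \<Rightarrow> bool" where
  "comaximal a c \<longleftrightarrow> (\<exists>u v. u * a + v * c = 1)"

definition monic_divisors :: "nat \<Rightarrow> 'a::comm_semiring_1 poly \<Rightarrow> 'a poly set" where
  "monic_divisors i f = {a \<in> monics i. a dvd f}"

definition comaximal_pairs :: "nat \<Rightarrow> nat \<Rightarrow> ('a::comm_semiring_1 poly \<times> 'a poly) set" where
  "comaximal_pairs i j = {(a, c) \<in> monics i \<times> monics j. comaximal a c}"

section \<open>Monic polynomials of fixed degree: counting, products, perturbations\<close>

lemma monics_nonzero: "a \<in> monics n \<Longrightarrow> a \<noteq> 0"
  by (auto simp: monics_def)

lemma monics_0: "monics 0 = {1 :: 'a::comm_semiring_1 poly}"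
  by (auto simp: monics_def elim!: degree_eq_zeroE)

text \<open>Splitting off the free constant coefficient drives the inductions for finiteness and for
  the count \<open>q^n\<close>.\<close>

lemma monics_Suc: "monics (Suc n) = (\<lambda>(c, p). pCons c p) ` (UNIV \<times> (monics n :: 'a::comm_semiring_1 poly set))"
proof (intro equalityI subsetI)
  fix f :: "'a poly" assume f: "f \<in> monics (Suc n)"
  obtain c p where [simp]: "f = pCons c p" by (cases f)
  from f have "p \<in> monics n" by (auto simp: monics_def split: if_splits)
  then show "f \<in> (\<lambda>(c, p). pCons c p) ` (UNIV \<times> monics n)" by auto
next
  fix f :: "'a poly" assume "f \<in> (\<lambda>(c, p). pCons c p) ` (UNIV \<times> monics n)"
  then show "f \<in> monics (Suc n)" by (auto simp: monics_def)
qed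

lemma finite_monics [simp]: "finite (monics n :: 'a::{comm_semiring_1,finite} poly set)"
  by (induction n) (auto simp: monics_0 monics_Suc)

lemma card_monics: "card (monics n :: 'a::{comm_semiring_1,finite} poly set) = CARD('a) ^ n"
proof (induction n)
  case (Suc n)
  have "inj_on (\<lambda>(c, p). pCons c p) (UNIV \<times> (monics n :: 'a poly set))"
    by (auto simp: inj_on_def)
  then show ?case
    by (simp add: monics_Suc card_image card_cartesian_product Suc)
qed (simp add: monics_0)

lemma monics_mult_iff:
  fixes a b :: "'a::idom poly"
  assumes "a \<in> monics i"
  shows "a * b \<in> monics n \<longleftrightarrow> i \<le> n \<and> b \<in> monics (n - i)"
proof (cases "b = 0")
  case False
  have "a \<noteq> 0" "lead_coeff a = 1" "degree a = i" using assms by (auto simp: monics_def)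
  with False have "degree (a * b) = i + degree b" "lead_coeff (a * b) = lead_coeff b"
    by (simp add: degree_mult_eq, metis lead_coeff_mult mult_1)
  then show ?thesis unfolding monics_def by auto
qed (simp add: monics_def)

text \<open>The disjunct \<open>r = 0\<close> matters for \<open>n = 0\<close>: the zero polynomial
  has degree 0, which is not below \<open>n\<close>.\<close>

lemma monics_add_lower_degree:
  fixes f r :: "'a::comm_ring_1 poly"
  assumes "r = 0 \<or> degree r < n"
  shows "r + f \<in> monics n \<longleftrightarrow> f \<in> monics n"
proof -
  have add: "g + s \<in> monics n" if "g \<in> monics n" "s = 0 \<or> degree s < n" for g s :: "'a poly"
    using that by (auto simp: monics_def degree_add_eq_left coeff_eq_0)
  show ?thesis
    using add[of f r] add[of "r + f" "- r"] assms by (auto simp: add.commute)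
qed

section \<open>The divisor function, split by degree\<close>

lemma monic_divisors_subset: "monic_divisors i f \<subseteq> monics i"
  by (auto simp: monic_divisors_def)

lemma finite_monic_divisors [simp]:
  "finite (monic_divisors i (f :: 'a::{comm_semiring_1,finite} poly))"
  by (rule finite_subset[OF monic_divisors_subset finite_monics])

lemma card_monic_divisors_cofactor:
  fixes f :: "'a::{field,finite} poly"
  assumes f: "f \<in> monics n" and i: "i \<le> n"
  shows "card (monic_divisors (n - i) f) = card (monic_divisors i f)"
proof -
  have cofactor: "f div a \<in> monic_divisors (n - k) f \<and> f div (f div a) = a"
    if "a \<in> monic_divisors k f" for a k
  proof -
    from that obtain b where a: "a \<in> monics k" and b: "f = a * b"
      by (auto simp: monic_divisors_def)
    have "b \<in> monics (n - k)" using f a b monics_mult_iff by blast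
    then show ?thesis using a b by (auto simp: monic_divisors_def dest: monics_nonzero)
  qed
  \<comment> \<open>Taking the cofactor is an involution, so the same map serves as its own
    inverse.\<close>
  have "bij_betw (\<lambda>a. f div a) (monic_divisors (n - i) f) (monic_divisors i f)"
    by (rule bij_betw_byWitness[where f' = "\<lambda>a. f div a"])
      (use cofactor[of _ i] cofactor[of _ "n - i"] i in auto)
  then show ?thesis by (rule bij_betw_same_card)
qed

lemma d2_eq_sum_monic_divisors:
  fixes f :: "'a::{field,finite} poly"
  assumes f: "f \<in> monics n"
  shows "d2 f = (\<Sum>i\<le>n. card (monic_divisors i f))"
proof -
  let ?P = "{(a, b). lead_coeff a = 1 \<and> lead_coeff b = 1 \<and> f = a * b}"
  let ?D = "\<Union>i\<in>{..n}. monic_divisors i f"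
  have "bij_betw fst ?P ?D"
  proof (rule bij_betw_imageI)
    \<comment> \<open>The first factor is nonzero, so cancellation recovers the second.\<close>
    show "inj_on fst ?P" by (auto simp: inj_on_def)
    show "fst ` ?P = ?D"
    proof (intro equalityI subsetI)
      fix a assume "a \<in> fst ` ?P"
      then obtain b where b: "lead_coeff a = 1" "f = a * b" by fastforce
      then have "a \<in> monics (degree a)" by (simp add: monics_def)
      moreover from this have "degree a \<le> n" using monics_mult_iff f b(2) by blast
      ultimately show "a \<in> ?D" using b by (auto simp: monic_divisors_def)
    next
      fix a assume "a \<in> ?D"
      then obtain i b where a: "a \<in> monics i" and b: "f = a * b"
        by (auto simp: monic_divisors_def elim!: dvdE)
      then have "b \<in> monics (n - i)" using monics_mult_iff f by blast
      then have "(a, b) \<in> ?P" using a b by (auto simp: monics_def)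
      then show "a \<in> fst ` ?P" by force
    qed
  qed
  then have "d2 f = card ?D" unfolding d2_def by (rule bij_betw_same_card)
  also have "\<dots> = (\<Sum>i\<le>n. card (monic_divisors i f))"
  proof (rule card_UN_disjoint)
    show "\<forall>i\<in>{..n}. \<forall>j\<in>{..n}. i \<noteq> j \<longrightarrow> monic_divisors i f \<inter> monic_divisors j f = {}"
      by (auto simp: monic_divisors_def monics_def)
  qed simp_all
  finally show ?thesis .
qed

text \<open>All degrees now lie at or below \<open>n div 2\<close>, so one degree for
  \<open>f\<close> and one for \<open>f + 1\<close> add up to at most \<open>n\<close>, as the
  Chinese remainder count requires.\<close>

lemma d2_eq_sum_small_monic_divisors:
  fixes f :: "'a::{field,finite} poly"
  assumes f: "f \<in> monics n"
  shows "d2 f = (\<Sum>i\<le>n. card (monic_divisors (min i (n - i)) f))"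
  unfolding d2_eq_sum_monic_divisors[OF f]
  by (rule sum.cong) (auto simp: min_def card_monic_divisors_cofactor[OF f])

section \<open>Simultaneous divisibility of f and f + 1\<close>

lemma card_monics_dvd_dvd_add_1:
  fixes a c :: "'a::{field,finite} poly"
  assumes a: "a \<in> monics i" and c: "c \<in> monics j" and n: "i + j \<le> n"
  shows "card {f \<in> monics n. a dvd f \<and> c dvd f + 1}
    = (if comaximal a c then CARD('a) ^ (n - (i + j)) else 0)"
proof (cases "comaximal a c")
  case True
  then obtain u v where uv: "u * a + v * c = 1" by (auto simp: comaximal_def)
  have ac: "a * c \<in> monics (i + j)" using a c by (simp add: monics_mult_iff)
  then have ac0: "a * c \<noteq> 0" and deg_ac: "degree (a * c) = i + j"
    by (auto simp: monics_def)
  \<comment> \<open>By the Bezout identity \<open>- u * a\<close> is 0 modulo \<open>a\<close> and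
    -1 modulo \<open>c\<close>. Reducing modulo \<open>a * c\<close> makes it 0 or of degree below
    \<open>i + j\<close>, so adding it preserves monicity in degree \<open>n\<close>.\<close>
  define r where "r = (- u * a) mod (a * c)"
  have r: "r = 0 \<or> degree r < n"
    using degree_mod_less[OF ac0, of "- u * a"] deg_ac n by (auto simp: r_def)
  have ar: "a dvd r" by (simp add: r_def dvd_mod)
  have "r + 1 = v * c - (- u * a) div (a * c) * (a * c)"
    using uv unfolding r_def minus_div_mult_eq_mod[symmetric] by (simp add: algebra_simps)
  then have cr: "c dvd r + 1" by simp
  have "{f \<in> monics n. a dvd f \<and> c dvd f + 1} = (\<lambda>h. r + a * c * h) ` monics (n - (i + j))"
  proof (intro equalityI subsetI)
    fix f assume "f \<in> {f \<in> monics n. a dvd f \<and> c dvd f + 1}"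
    then have f: "f \<in> monics n" "a dvd f" "c dvd f + 1" by auto
    have af: "a dvd f - r" using f ar by simp
    have cf: "c dvd f - r" using dvd_diff[OF f(3) cr] by simp
    \<comment> \<open>Multiplying the Bezout identity by \<open>f - r\<close>: in each summand one
      of \<open>a\<close>, \<open>c\<close> is explicit and the other divides
      \<open>f - r\<close>.\<close>
    have "f - r = u * a * (f - r) + v * c * (f - r)"
      using uv by (metis distrib_right mult_1)
    moreover have "a * c dvd u * a * (f - r)" "a * c dvd v * c * (f - r)"
      using af cf by (auto elim!: dvdE)
    ultimately have "a * c dvd f - r" by (metis dvd_add)
    then obtain h where h: "f = r + a * c * h" by (metis dvdE diff_add_cancel add.commute)
    then have "h \<in> monics (n - (i + j))"
      using f(1) monics_add_lower_degree[OF r] monics_mult_iff[OF ac] by blast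
    then show "f \<in> (\<lambda>h. r + a * c * h) ` monics (n - (i + j))" using h by blast
  next
    fix f assume "f \<in> (\<lambda>h. r + a * c * h) ` monics (n - (i + j))"
    then obtain h where h: "h \<in> monics (n - (i + j))" "f = r + a * c * h" by blast
    have "f \<in> monics n"
      using h n by (simp add: monics_add_lower_degree[OF r] monics_mult_iff[OF ac])
    moreover have "a dvd f" using h ar by (simp add: mult.assoc)
    moreover have "f + 1 = (r + 1) + c * (a * h)" using h by (simp add: algebra_simps)
    then have "c dvd f + 1" using cr by (metis dvd_add dvd_triv_left)
    ultimately show "f \<in> {f \<in> monics n. a dvd f \<and> c dvd f + 1}" by simp
  qed
  moreover have "inj_on (\<lambda>h. r + a * c * h) (monics (n - (i + j)))"
    using ac0 by (auto simp: inj_on_def)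
  ultimately show ?thesis using True by (simp add: card_image card_monics)
next
  case False
  have "\<not> (a dvd f \<and> c dvd f + 1)" for f
  proof
    assume "a dvd f \<and> c dvd f + 1"
    then obtain x y where "f = a * x" "f + 1 = c * y" by (auto elim!: dvdE)
    \<comment> \<open>Any solution \<open>f\<close> yields a Bezout identity, since
      \<open>(f + 1) - f = 1\<close>.\<close>
    then have "- x * a + y * c = 1" by (simp add: algebra_simps)
    then show False using False comaximal_def by blast
  qed
  then show ?thesis using False by simp
qed

section \<open>Monic gcds and the number of comaximal pairs\<close>

text \<open>A nonzero element of least degree in the ideal generated by \<open>a\<close> and
  \<open>c\<close> divides both; scaling makes it monic.\<close>

lemma exists_monic_gcd:
  fixes a c :: "'a::field poly"
  assumes "a \<noteq> 0"
  shows "\<exists>g u v. lead_coeff g = 1 \<and> g dvd a \<and> g dvd c \<and> u * a + v * c = g"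
proof -
  define I where "I = {g. g \<noteq> 0 \<and> (\<exists>u v. u * a + v * c = g)}"
  have "1 * a + 0 * c = a" by simp
  then have "a \<in> I" using assms unfolding I_def by blast
  then obtain g where g: "g \<in> I" and min: "\<And>h. h \<in> I \<Longrightarrow> degree g \<le> degree h"
    using ex_has_least_nat[of "\<lambda>g. g \<in> I" a degree] by blast
  from g obtain u v where g0: "g \<noteq> 0" and uv: "u * a + v * c = g" by (auto simp: I_def)
  have dvd: "g dvd s * a + t * c" for s t
  proof (rule ccontr)
    let ?x = "s * a + t * c"
    assume "\<not> g dvd ?x"
    then have nz: "?x mod g \<noteq> 0" by (simp add: dvd_eq_mod_eq_0)
    \<comment> \<open>The remainder is again a combination of \<open>a\<close> and \<open>c\<close>;
      being nonzero, it would contradict the minimality of \<open>degree g\<close>.\<close>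
    have "?x mod g = (s - ?x div g * u) * a + (t - ?x div g * v) * c"
      unfolding minus_div_mult_eq_mod[symmetric] uv[symmetric] by (simp add: algebra_simps)
    then have "?x mod g \<in> I" using nz unfolding I_def by (smt (verit) mem_Collect_eq)
    then have "degree g \<le> degree (?x mod g)" by (rule min)
    then show False using degree_mod_less[OF g0, of ?x] nz by auto
  qed
  define k where "k = inverse (lead_coeff g)"
  have k: "k \<noteq> 0" "k * lead_coeff g = 1" using g0 by (auto simp: k_def)
  have "lead_coeff (smult k g) = 1" using k by simp
  moreover have "smult k g dvd a" "smult k g dvd c"
    using dvd[of 1 0] dvd[of 0 1] k by (simp_all add: smult_dvd_iff)
  moreover have "smult k u * a + smult k v * c = smult k g"
    by (simp add: uv[symmetric] smult_add_right)
  ultimately show ?thesis by blast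
qed

text \<open>Mutual divisibility equates the degrees, so the cofactor is monic of degree 0, hence
  1.\<close>

lemma monic_dvd_antisym:
  fixes g h :: "'a::idom poly"
  assumes g: "g \<in> monics k" and h: "h \<in> monics l" and "g dvd h" "h dvd g"
  shows "g = h"
proof -
  from assms obtain x where x: "h = g * x" by (auto elim!: dvdE)
  have nz: "g \<noteq> 0" "h \<noteq> 0" using g h by (auto dest: monics_nonzero)
  have "k = l"
    using dvd_imp_degree_le[OF \<open>g dvd h\<close> nz(2)] dvd_imp_degree_le[OF \<open>h dvd g\<close> nz(1)] g h
    by (simp add: monics_def)
  then have "x \<in> monics 0" using monics_mult_iff[OF g, of x l] h x by simp
  then show ?thesis using x by (simp add: monics_0)
qed

text \<open>Multiplying the Bezout identity by \<open>g\<close> writes \<open>g\<close> as a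
  combination of two multiples of \<open>h\<close>. Used in both directions, this makes the
  extracted gcd unique.\<close>

lemma comaximal_factor_dvd:
  fixes g h a c a' c' :: "'a::comm_ring_1"
  assumes "comaximal a c" "g * a = h * a'" "g * c = h * c'"
  shows "h dvd g"
proof -
  from assms(1) obtain u v where "u * a + v * c = 1" by (auto simp: comaximal_def)
  then have "g = u * (g * a) + v * (g * c)"
    by (metis distrib_left mult.left_commute mult.right_neutral)
  also have "\<dots> = h * (u * a' + v * c')" unfolding assms(2,3) by (simp add: algebra_simps)
  finally have "g = h * (u * a' + v * c')" .
  then show ?thesis by (rule dvdI)
qed

lemma finite_comaximal_pairs [simp]:
  "finite (comaximal_pairs i j :: ('a::{comm_semiring_1,finite} poly \<times> 'a poly) set)"
  by (rule finite_subset[of _ "monics i \<times> monics j"]) (auto simp: comaximal_pairs_def)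

text \<open>Each pair of monics is uniquely \<open>(g * a, g * c)\<close> with \<open>g\<close>
  monic and \<open>(a, c)\<close> comaximal; the sum sorts the pairs by \<open>k = degree g\<close>,
  with \<open>q^k\<close> choices of \<open>g\<close>.\<close>

lemma sum_card_comaximal_pairs:
  "(\<Sum>k\<le>min i j. CARD('a) ^ k * card (comaximal_pairs (i - k) (j - k) ::
      ('a::{field,finite} poly \<times> 'a poly) set)) = CARD('a) ^ (i + j)"
proof -
  let ?S = "SIGMA k:{..min i j}.
    (monics k :: 'a poly set) \<times> (comaximal_pairs (i - k) (j - k) :: ('a poly \<times> 'a poly) set)"
  let ?F = "\<lambda>(k :: nat, g :: 'a poly, a, c). (g * a, g * c)"
  have "bij_betw ?F ?S (monics i \<times> monics j)"
  proof (rule bij_betw_imageI)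
    show "inj_on ?F ?S"
    proof (rule inj_onI)
      fix x y assume x: "x \<in> ?S" and y: "y \<in> ?S" and eq: "?F x = ?F y"
      obtain k g a c where [simp]: "x = (k, g, a, c)" by (cases x) auto
      obtain l h a' c' where [simp]: "y = (l, h, a', c')" by (cases y) auto
      have g: "g \<in> monics k" and h: "h \<in> monics l" and ac: "comaximal a c" "comaximal a' c'"
        using x y by (auto simp: comaximal_pairs_def)
      have "g * a = h * a'" "g * c = h * c'" using eq by auto
      then have "g = h"
        using monic_dvd_antisym[OF g h] comaximal_factor_dvd[OF ac(1)]
          comaximal_factor_dvd[OF ac(2)] by metis
      moreover from this have "k = l" using g h by (auto simp: monics_def)
      ultimately show "x = y" using eq monics_nonzero[OF g] by auto
    qed
    show "?F ` ?S = monics i \<times> monics j"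
    proof (intro equalityI subsetI)
      fix z assume "z \<in> ?F ` ?S"
      then obtain k g a c where "k \<le> min i j" "g \<in> monics k" "a \<in> monics (i - k)"
        "c \<in> monics (j - k)" "z = (g * a, g * c)"
        by (auto simp: comaximal_pairs_def)
      then show "z \<in> monics i \<times> monics j" by (simp add: monics_mult_iff)
    next
      fix z :: "'a poly \<times> 'a poly" assume "z \<in> monics i \<times> monics j"
      then obtain a c where z: "z = (a, c)" and a: "a \<in> monics i" and c: "c \<in> monics j" by auto
      obtain g u v where g: "lead_coeff g = 1" "g dvd a" "g dvd c" "u * a + v * c = g"
        using exists_monic_gcd[OF monics_nonzero[OF a]] by blast
      then obtain a' c' where a': "a = g * a'" and c': "c = g * c'" by (auto elim!: dvdE)
      let ?k = "degree g"
      have gk: "g \<in> monics ?k" using g by (simp add: monics_def)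
      \<comment> \<open>Cancelling \<open>g\<close> from its own Bezout representation leaves one
        for the cofactors.\<close>
      have "g * (u * a' + v * c') = g * 1" using g(4) a' c' by (simp add: algebra_simps)
      then have "comaximal a' c'"
        using monics_nonzero[OF gk] unfolding comaximal_def by (metis mult_left_cancel)
      moreover have "?k \<le> i" "a' \<in> monics (i - ?k)" "?k \<le> j" "c' \<in> monics (j - ?k)"
        using a c a' c' monics_mult_iff[OF gk] by auto
      ultimately have "(?k, g, a', c') \<in> ?S" using gk by (simp add: comaximal_pairs_def)
      then show "z \<in> ?F ` ?S" using z a' c' by force
    qed
  qed
  then have "card ?S = card ((monics i :: 'a poly set) \<times> (monics j :: 'a poly set))"
    by (rule bij_betw_same_card)
  then show ?thesis
    by (simp add: card_cartesian_product card_monics power_add)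
qed

text \<open>In the sum over the degree of the gcd, the terms of positive degree are \<open>q\<close> times the same sum
  for \<open>(i - 1, j - 1)\<close>.\<close>

lemma card_comaximal_pairs:
  "real (card (comaximal_pairs i j :: ('a::{field,finite} poly \<times> 'a poly) set))
    = real CARD('a) ^ (i + j) * (1 - of_bool (i > 0 \<and> j > 0) / real CARD('a))"
proof (cases "i > 0 \<and> j > 0")
  case True
  let ?q = "CARD('a)"
  let ?N = "\<lambda>i j. card (comaximal_pairs i j :: ('a poly \<times> 'a poly) set)"
  obtain i' j' where ij: "i = Suc i'" "j = Suc j'" using True by (metis gr0_implies_Suc)
  have "?q ^ (i + j) = (\<Sum>k\<le>Suc (min i' j'). ?q ^ k * ?N (i - k) (j - k))"
    using sum_card_comaximal_pairs[where ?'a = 'a, of i j] by (simp add: ij)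
  also have "\<dots> = ?N i j + ?q * (\<Sum>k\<le>min i' j'. ?q ^ k * ?N (i' - k) (j' - k))"
    by (subst sum.atMost_Suc_shift) (simp add: ij sum_distrib_left mult.assoc)
  also have "\<dots> = ?N i j + ?q * ?q ^ (i' + j')"
    by (simp only: sum_card_comaximal_pairs)
  finally have "real (?q ^ (i + j)) = real (?N i j + ?q * ?q ^ (i' + j'))" by (rule arg_cong)
  then show ?thesis using True by (simp add: ij field_simps)
next
  case False
  \<comment> \<open>If one degree is 0, only the term \<open>k = 0\<close> remains: every pair is
    comaximal.\<close>
  then have "min i j = 0" by auto
  then have "card (comaximal_pairs i j :: ('a poly \<times> 'a poly) set) = CARD('a) ^ (i + j)"
    using sum_card_comaximal_pairs[where ?'a = 'a, of i j] by simp
  then show ?thesis using False by simp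
qed

section \<open>Averaging over f and summing over degrees\<close>

text \<open>Double counting of triples \<open>(f, a, c)\<close>: for fixed \<open>(a, c)\<close> the
  number of \<open>f\<close> is known. The powers of \<open>q\<close> recombine to
  \<open>q^n\<close>, so the value depends only on whether both degrees are positive.\<close>

lemma sum_card_monic_divisors_shift:
  assumes n: "i + j \<le> n"
  shows "(\<Sum>f\<in>(monics n :: 'a::{field,finite} poly set).
      real (card (monic_divisors i f)) * real (card (monic_divisors j (f + 1))))
    = real CARD('a) ^ n * (1 - of_bool (i > 0 \<and> j > 0) / real CARD('a))"
proof -
  let ?q = "CARD('a)"
  let ?M = "monics n :: 'a poly set" and ?A = "monics i \<times> monics j :: ('a poly \<times> 'a poly) set"
  have "(\<Sum>f\<in>?M. card (monic_divisors i f) * card (monic_divisors j (f + 1)))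
      = (\<Sum>f\<in>?M. card {(a, c) \<in> ?A. a dvd f \<and> c dvd f + 1})"
    unfolding card_cartesian_product[symmetric]
    by (intro sum.cong refl arg_cong[where f = card]) (auto simp: monic_divisors_def)
  \<comment> \<open>Cardinalities become sums of indicators so that the order of summation can be
    exchanged.\<close>
  also have "\<dots> = (\<Sum>f\<in>?M. \<Sum>p\<in>?A. of_bool (fst p dvd f \<and> snd p dvd f + 1))"
    by (intro sum.cong refl, subst sum_of_bool_eq)
      (auto intro!: arg_cong[where f = card])
  also have "\<dots> = (\<Sum>p\<in>?A. \<Sum>f\<in>?M. of_bool (fst p dvd f \<and> snd p dvd f + 1))"
    by (rule sum.swap)
  also have "\<dots> = (\<Sum>p\<in>?A. card {f \<in> ?M. fst p dvd f \<and> snd p dvd f + 1})"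
    by (intro sum.cong refl, subst sum_of_bool_eq)
      (auto intro!: arg_cong[where f = card])
  also have "\<dots> = (\<Sum>p\<in>?A. of_bool (comaximal (fst p) (snd p)) * ?q ^ (n - (i + j)))"
  proof (intro sum.cong refl)
    fix p :: "'a poly \<times> 'a poly" assume "p \<in> ?A"
    then have "fst p \<in> monics i" "snd p \<in> monics j" by auto
    from card_monics_dvd_dvd_add_1[OF this n]
    show "card {f \<in> ?M. fst p dvd f \<and> snd p dvd f + 1}
        = of_bool (comaximal (fst p) (snd p)) * ?q ^ (n - (i + j))" by simp
  qed
  also have "\<dots> = card (comaximal_pairs i j :: ('a poly \<times> 'a poly) set) * ?q ^ (n - (i + j))"
    unfolding sum_distrib_right[symmetric]
    by (subst sum_of_bool_eq) (auto simp: comaximal_pairs_def intro!: arg_cong[where f = card])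
  finally have "real (\<Sum>f\<in>?M. card (monic_divisors i f) * card (monic_divisors j (f + 1)))
      = real (card (comaximal_pairs i j :: ('a poly \<times> 'a poly) set) * ?q ^ (n - (i + j)))"
    by (rule arg_cong)
  moreover have "real ?q ^ n = real ?q ^ (i + j) * real ?q ^ (n - (i + j))"
    using n by (simp flip: power_add)
  ultimately show ?thesis by (simp add: card_comaximal_pairs)
qed

theorem theorem7p1:
  fixes q n :: nat
  assumes "CARD('a::{field,finite}) = q" and "n \<ge> 1"
  shows "1 / real q ^ n * (\<Sum>f\<in>(monics n :: 'a poly set). real (d2 f) * real (d2 (f + 1)))
         = (real n + 1)\<^sup>2 - 1 / real q * (real n - 1)\<^sup>2"
proof -
  define m where "m i = min i (n - i)" for i
  define e :: "nat \<Rightarrow> real" where "e i = of_bool (m i > 0)" for i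
  let ?M = "monics n :: 'a poly set"
  have q: "q > 0" using assms(1) by auto
  \<comment> \<open>For \<open>n \<ge> 1\<close> the constant 1 has degree below \<open>n\<close>,
    so the shift stays within the monics of degree \<open>n\<close>.\<close>
  have succ: "f + 1 \<in> ?M" if "f \<in> ?M" for f
    using that \<open>n \<ge> 1\<close> monics_add_lower_degree[of 1 n f] by (simp add: add.commute)
  have "(\<Sum>f\<in>?M. real (d2 f) * real (d2 (f + 1)))
      = (\<Sum>f\<in>?M. \<Sum>i\<le>n. \<Sum>j\<le>n.
          real (card (monic_divisors (m i) f)) * real (card (monic_divisors (m j) (f + 1))))"
    by (intro sum.cong refl)
      (simp add: d2_eq_sum_small_monic_divisors[of _ n] succ m_def sum_product)
  also have "\<dots> = (\<Sum>i\<le>n. \<Sum>j\<le>n. \<Sum>f\<in>?M.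
          real (card (monic_divisors (m i) f)) * real (card (monic_divisors (m j) (f + 1))))"
    by (subst sum.swap, intro sum.cong refl, rule sum.swap)
  also have "\<dots> = (\<Sum>i\<le>n. \<Sum>j\<le>n. real q ^ n * (1 - e i * e j / real q))"
  proof (intro sum.cong refl)
    fix i j
    have "m k \<le> n div 2" for k by (auto simp: m_def min_def)
    from this[of i] this[of j] have "m i + m j \<le> n" by linarith
    then show "(\<Sum>f\<in>?M. real (card (monic_divisors (m i) f)) * real (card (monic_divisors (m j) (f + 1))))
        = real q ^ n * (1 - e i * e j / real q)"
      using assms(1) by (simp add: sum_card_monic_divisors_shift e_def of_bool_conj)
  qed
  \<comment> \<open>The correction \<open>e i * e j\<close> is a product, so its double sum is a
    square; the constant term counts the \<open>(n + 1)^2\<close> index pairs.\<close>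
  also have "\<dots> = real q ^ n * ((real n + 1)\<^sup>2 - 1 / real q * (\<Sum>i\<le>n. e i)\<^sup>2)"
    by (simp add: sum_subtractf power2_eq_square sum_product add.commute
        flip: sum_distrib_left sum_divide_distrib)
  also have "(\<Sum>i\<le>n. e i) = real n - 1"
  proof -
    \<comment> \<open>\<open>m i\<close> vanishes exactly at the two ends \<open>i = 0\<close> and
      \<open>i = n\<close>, leaving \<open>n - 1\<close> interior degrees (none if
      \<open>n = 1\<close>).\<close>
    have "{..n} \<inter> {i. m i > 0} = {1..<n}" by (auto simp: m_def)
    then show ?thesis using \<open>n \<ge> 1\<close> by (simp add: e_def sum_of_bool_eq of_nat_diff)
  qed
  finally show ?thesis using q by simp
qed

end
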